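(* Let $X=c_{0}(\mathbb{N},\mathbb{R})$ be the real Banach space of null sequences with the supremum norm. Then $$wk_{X^{*}}(A)=\eta_{1}(A)$$ for each bounded subset $A$ of $X^{*}$.
   Context: For a bounded subset $A$ of a Banach space $Z$, $wk_Z(A)=\sup\{d(z^{**},Z): z^{**}\in\overline{A}^{w^{*}}\}$, where $\overline{A}^{w^{*}}$ is the weak$^{*}$ closure of $A$ in $Z^{**}$ and $d(z^{**},Z)=\inf_{z\in Z}\|z^{**}-z\|$. (Here it is applied with $Z=X^{*}$, so the closure is taken in $X^{***}$.) A sequence $(x_n)_n$ in a Banach space $X$ is weakly $1$-summable if $\sum_n|\langle x^{*},x_n\rangle|<\infty$ for all $x^{*}\in X^{*}$; then $\|(x_n)_n\|_1^w=\sup\{\sum_n|\langle x^{*},x_n\rangle|: x^{*}\in B_{X^{*}}\}$, where $B_{X^*}$ is the closed unit ball of $X^*$, and $l_1^w(X)$ denotes the space of such sequences. For a bounded subset $A$ of $X^{*}$, $$\eta_{1}(A)=\sup\Big\{\limsup_{n}\sup_{x^{*}\in A}|\langle x^{*},x_n\rangle|: (x_{n})_{n}\in l^{w}_{1}(X),\ \|(x_{n})_{n}\|_{1}^{w}\leq 1\Big\}.$$ *)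

theory Defs
  imports "HOL-Analysis.Analysis"
begin

typedef c0 = "{x :: nat \<Rightarrow> real. x \<longlonglongrightarrow> 0}"
  morphisms seq_of Abs_c0
  by (auto intro!: exI[of _ "\<lambda>_. 0"])

setup_lifting type_definition_c0

lemma c0_eqI: "(\<And>n. seq_of x n = seq_of y n) \<Longrightarrow> x = y"
  by transfer auto

lemma seq_of_tendsto: "seq_of x \<longlonglongrightarrow> 0"
  using seq_of[of x] by simp

instantiation c0 :: real_vector
begin

lift_definition zero_c0 :: c0 is "\<lambda>_. 0"
  by simp

lift_definition plus_c0 :: "c0 \<Rightarrow> c0 \<Rightarrow> c0" is "\<lambda>x y n. x n + y n"
  by (auto intro: tendsto_add_zero)

lift_definition uminus_c0 :: "c0 \<Rightarrow> c0" is "\<lambda>x n. - x n"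
  using tendsto_minus by fastforce

lift_definition minus_c0 :: "c0 \<Rightarrow> c0 \<Rightarrow> c0" is "\<lambda>x y n. x n - y n"
  using tendsto_diff by fastforce

lift_definition scaleR_c0 :: "real \<Rightarrow> c0 \<Rightarrow> c0" is "\<lambda>a x n. a * x n"
  by (auto intro: tendsto_mult_right_zero)

instance
  by standard (transfer; auto simp: algebra_simps fun_eq_iff)+

end

lemmas [simp] = zero_c0.rep_eq plus_c0.rep_eq uminus_c0.rep_eq minus_c0.rep_eq scaleR_c0.rep_eq

lemma bdd_above_seq_of: "bdd_above (range (\<lambda>n. \<bar>seq_of x n\<bar>))"
proof -
  have "Bseq (seq_of x)"
    using seq_of_tendsto convergent_imp_Bseq convergentI by blast
  then obtain K where "\<And>n. norm (seq_of x n) \<le> K"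
    by (auto simp: Bseq_def)
  then show ?thesis
    by (auto intro!: bdd_aboveI[of _ K])
qed

instantiation c0 :: real_normed_vector
begin

definition norm_c0 :: "c0 \<Rightarrow> real"
  where "norm_c0 x = (SUP n. \<bar>seq_of x n\<bar>)"

definition dist_c0 :: "c0 \<Rightarrow> c0 \<Rightarrow> real"
  where "dist_c0 x y = norm (x - y)"

definition sgn_c0 :: "c0 \<Rightarrow> c0"
  where "sgn_c0 x = x /\<^sub>R norm x"

definition uniformity_c0 :: "(c0 \<times> c0) filter"
  where "uniformity_c0 = (INF e\<in>{0 <..}. principal {(x, y). dist x y < e})"

definition open_c0 :: "c0 set \<Rightarrow> bool"
  where "open_c0 S = (\<forall>x\<in>S. \<forall>\<^sub>F (x', y) in uniformity. x' = x \<longrightarrow> y \<in> S)"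

lemma abs_seq_of_le_norm: "\<bar>seq_of x n\<bar> \<le> norm x"
  unfolding norm_c0_def by (rule cSUP_upper[OF _ bdd_above_seq_of]) simp

lemma norm_c0_le: "(\<And>n. \<bar>seq_of x n\<bar> \<le> b) \<Longrightarrow> norm x \<le> b"
  unfolding norm_c0_def by (rule cSUP_least) auto

instance
proof
  fix a :: real and x y :: c0
  have nonneg: "0 \<le> norm z" for z :: c0
    using abs_seq_of_le_norm[of z 0] by linarith
  show "(norm x = 0) = (x = 0)"
  proof
    assume "norm x = 0"
    then show "x = 0"
      using abs_seq_of_le_norm[of x] by (intro c0_eqI) auto
  next
    assume "x = 0"
    then have "norm x \<le> 0" by (intro norm_c0_le) simp
    then show "norm x = 0" using nonneg[of x] by simp
  qed
  show "norm (x + y) \<le> norm x + norm y"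
  proof (rule norm_c0_le)
    fix n
    show "\<bar>seq_of (x + y) n\<bar> \<le> norm x + norm y"
      using abs_seq_of_le_norm[of x n] abs_seq_of_le_norm[of y n] by simp
  qed
  have scale_le: "norm (b *\<^sub>R z) \<le> \<bar>b\<bar> * norm z" for b and z :: c0
    by (rule norm_c0_le) (simp add: abs_mult mult_left_mono abs_seq_of_le_norm)
  show "norm (a *\<^sub>R x) = \<bar>a\<bar> * norm x"
  proof (cases "a = 0")
    case True
    then show ?thesis using scale_le[of a x] nonneg[of "a *\<^sub>R x"] by simp
  next
    case False
    have "\<bar>a\<bar> * norm x = \<bar>a\<bar> * norm (inverse a *\<^sub>R a *\<^sub>R x)"
      using False by simp
    also have "\<dots> \<le> \<bar>a\<bar> * (\<bar>inverse a\<bar> * norm (a *\<^sub>R x))"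
      by (intro mult_left_mono scale_le) simp
    also have "\<dots> = norm (a *\<^sub>R x)"
      using False by simp
    finally show ?thesis using scale_le[of a x] by simp
  qed
qed (auto simp: dist_c0_def sgn_c0_def uniformity_c0_def open_c0_def)

end

instance c0 :: banach
proof
  fix X :: "nat \<Rightarrow> c0"
  assume C: "Cauchy X"
  have "\<exists>M. \<forall>m\<ge>M. \<forall>k\<ge>M. \<forall>n. dist (seq_of (X m) n) (seq_of (X k) n) < e" if "e > 0" for e
  proof -
    obtain M where M: "\<And>m k. m \<ge> M \<Longrightarrow> k \<ge> M \<Longrightarrow> norm (X m - X k) < e"
      using C \<open>e > 0\<close> by (auto simp: Cauchy_def dist_norm) blast
    show ?thesis
    proof (intro exI allI impI)
      fix m k n assume "m \<ge> M" "k \<ge> M"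
      then show "dist (seq_of (X m) n) (seq_of (X k) n) < e"
        using M[of m k] abs_seq_of_le_norm[of "X m - X k" n] by (simp add: dist_real_def)
    qed
  qed
  then have "uniformly_Cauchy_on UNIV (\<lambda>m. seq_of (X m))"
    unfolding uniformly_Cauchy_on_def by meson
  then obtain l where l: "uniform_limit UNIV (\<lambda>m. seq_of (X m)) l sequentially"
    using Cauchy_uniformly_convergent uniformly_convergent_on_def by blast
  have "l \<longlonglongrightarrow> 0"
  proof (rule tendstoI)
    fix e :: real assume "e > 0"
    then have "\<forall>\<^sub>F m in sequentially. \<forall>n\<in>UNIV. dist (seq_of (X m) n) (l n) < e / 2"
      by (intro uniform_limitD[OF l]) simp
    then obtain m where m: "\<And>n. dist (seq_of (X m) n) (l n) < e / 2"
      by (auto simp: eventually_sequentially)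
    have "\<forall>\<^sub>F n in sequentially. dist (seq_of (X m) n) 0 < e / 2"
      using seq_of_tendsto \<open>e > 0\<close> by (intro tendstoD) auto
    then show "\<forall>\<^sub>F n in sequentially. dist (l n) 0 < e"
    proof eventually_elim
      case (elim n)
      then show ?case using m[of n] unfolding dist_real_def by linarith
    qed
  qed
  then have seq_l: "seq_of (Abs_c0 l) = l"
    by (simp add: Abs_c0_inverse)
  have "X \<longlonglongrightarrow> Abs_c0 l"
  proof (rule tendstoI)
    fix e :: real assume "e > 0"
    then have "\<forall>\<^sub>F m in sequentially. \<forall>n\<in>UNIV. dist (seq_of (X m) n) (l n) < e / 2"
      by (intro uniform_limitD[OF l]) simp
    then show "\<forall>\<^sub>F m in sequentially. dist (X m) (Abs_c0 l) < e"
    proof eventually_elim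
      case (elim m)
      then have "norm (X m - Abs_c0 l) \<le> e / 2"
        by (intro norm_c0_le) (auto simp: seq_l dist_real_def less_imp_le)
      then show ?case using \<open>e > 0\<close> by (simp add: dist_norm)
    qed
  qed
  then show "convergent X" by (rule convergentI)
qed

lift_definition bidual_embedding :: "'z::real_normed_vector \<Rightarrow> ('z \<Rightarrow>\<^sub>L real) \<Rightarrow>\<^sub>L real"
  is "\<lambda>z f. blinfun_apply f z"
  by (rule blinfun.bounded_linear_left)

text \<open>For scalar-valued operators the strong operator topology is the topology of pointwise
  convergence, that is, the weak* topology of the dual space.\<close>

abbreviation weak_star_topology :: "('z::real_normed_vector \<Rightarrow>\<^sub>L real) topology"
  where "weak_star_topology \<equiv> strong_operator_topology"

text \<open>The suprema below are of nonnegative numbers and are taken in \<^typ>\<open>ennreal\<close>,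
  so that every supremum exists and suprema over the empty set are \<open>0\<close>.\<close>

definition wk :: "'z::banach set \<Rightarrow> ennreal"
  where "wk A =
    (SUP \<phi>\<in>weak_star_topology closure_of (bidual_embedding ` A).
      ennreal (infdist \<phi> (range bidual_embedding)))"

definition weakly_1_summable :: "(nat \<Rightarrow> 'x::banach) \<Rightarrow> bool"
  where "weakly_1_summable x \<longleftrightarrow> (\<forall>f :: 'x \<Rightarrow>\<^sub>L real. summable (\<lambda>n. \<bar>blinfun_apply f (x n)\<bar>))"

definition weak_1_norm :: "(nat \<Rightarrow> 'x::banach) \<Rightarrow> ennreal"
  where "weak_1_norm x =
    (SUP f\<in>cball (0 :: 'x \<Rightarrow>\<^sub>L real) 1. \<Sum>n. ennreal \<bar>blinfun_apply f (x n)\<bar>)"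

definition eta1 :: "('x::banach \<Rightarrow>\<^sub>L real) set \<Rightarrow> ennreal"
  where "eta1 A =
    (SUP x\<in>{x. weakly_1_summable x \<and> weak_1_norm x \<le> 1}.
      limsup (\<lambda>n. SUP f\<in>A. ennreal \<bar>blinfun_apply f (x n)\<bar>))"

end

theory Submission
  imports Defs
begin

text \<open>
  Both quantities measure how far the coefficient series of the functionals in \<open>A\<close> are from
  being uniformly summable. A functional \<open>f\<close> on \<open>c\<^sub>0\<close> is an absolutely summable sequence of
  coefficients \<open>f(e\<^sub>k)\<close>, with norm equal to the sum of their absolute values. Put
  \<open>tail f n = (\<Sum>k\<ge>n. \<bar>f(e\<^sub>k)\<bar>)\<close> and let the uniform tail of \<open>A\<close> be the infimum over \<open>n\<close> of the
  supremum of \<open>tail f n\<close> over \<open>f \<in> A\<close>. The measure \<open>\<eta>\<^sub>1\<close> and the measure \<open>wk\<close> are both shown to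
  equal it.

  For \<open>\<eta>\<^sub>1\<close>: the terms of a weakly 1-summable sequence converge to \<open>0\<close> in each coordinate, so
  their first \<open>N\<close> coordinates do not contribute to the limit superior, and the other coordinates
  contribute at most the supremum of \<open>tail f N\<close>. Conversely, sign vectors on disjoint finite
  blocks form a weakly 1-summable sequence of norm at most \<open>1\<close>, and they detect the mass that the
  functionals in \<open>A\<close> put on these blocks.

  For \<open>wk\<close>: let \<open>\<phi>\<close> be in the weak* closure of \<open>A\<close> and let \<open>f\<close> be the restriction of \<open>\<phi>\<close> to \<open>c\<^sub>0\<close>.
  Then \<open>\<phi> - f\<close> vanishes on \<open>c\<^sub>0\<close>, so an element of the bidual can be cut down to its coordinates
  from \<open>n\<close> on before \<open>\<phi> - f\<close> is applied to it; there \<open>\<phi>\<close> is controlled by the tails of \<open>A\<close>. Hence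
  the distance of \<open>\<phi>\<close> to the dual is at most the uniform tail. Conversely, choose functionals of
  \<open>A\<close> with large tails, take a weak* cluster point \<open>f\<close> of them on \<open>c\<^sub>0\<close>, and pass to functionals
  \<open>g\<^sub>k\<close> such that \<open>g\<^sub>k - f\<close> is almost concentrated on a block, the blocks being consecutive (a
  gliding hump). One bounded sign sequence then pairs well with all differences \<open>g\<^sub>k - f\<close>
  simultaneously, even after finitely many of its terms are deleted. As deleting initial terms
  makes its pairing with any fixed element of the dual small, a cluster point of the \<open>g\<^sub>k\<close> in the
  third dual stays far from every element of the dual.
\<close>

section \<open>Weak* cluster points\<close>

text \<open>Neighbourhoods are taken in the space of all functions with the topology of pointwise
  convergence, which induces the weak* topology on functionals. In this form the compactness and
  continuity results for filters on topological spaces apply directly.\<close>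

definition weak_star_cluster_point ::
    "(nat \<Rightarrow> ('z::real_normed_vector \<Rightarrow>\<^sub>L real)) \<Rightarrow> ('z \<Rightarrow>\<^sub>L real) \<Rightarrow> bool"
  where "weak_star_cluster_point b \<phi> \<longleftrightarrow>
    (\<forall>P. eventually P (nhds (blinfun_apply \<phi>)) \<longrightarrow>
      (\<exists>\<^sub>F j in sequentially. P (blinfun_apply (b j))))"

text \<open>A sequential consequence of the Banach-Alaoglu theorem. By Tychonoff's theorem the sequence
  has a pointwise cluster point in a product of compact intervals; additivity and homogeneity are
  closed conditions for pointwise convergence, so they pass to the cluster point.\<close>

lemma weak_star_cluster_point_exists:
  fixes b :: "nat \<Rightarrow> ('z::real_normed_vector \<Rightarrow>\<^sub>L real)"
  assumes bound: "\<And>j. norm (b j) \<le> M"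
  obtains \<phi> where "weak_star_cluster_point b \<phi>"
proof -
  define K where "K = (PiE UNIV (\<lambda>z. cball 0 (M * norm z)) :: ('z \<Rightarrow> real) set)"
  have "compactin (product_topology (\<lambda>_. euclidean) UNIV) K"
    unfolding K_def by (subst compactin_PiE) auto
  then have "compact K"
    by (simp add: euclidean_product_topology)
  moreover have in_K: "blinfun_apply (b j) \<in> K" for j
  proof -
    have "\<bar>blinfun_apply (b j) z\<bar> \<le> M * norm z" for z
      using norm_blinfun[of "b j" z] mult_right_mono[OF bound[of j], of "norm z"] by simp
    then show ?thesis by (auto simp: K_def)
  qed
  moreover have "filtermap (\<lambda>j. blinfun_apply (b j)) sequentially \<noteq> bot"
    by (simp add: filtermap_bot_iff)
  ultimately obtain g where "g \<in> K"
    and g: "inf (nhds g) (filtermap (\<lambda>j. blinfun_apply (b j)) sequentially) \<noteq> bot"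
    unfolding compact_filter by (auto simp: eventually_filtermap)
  have freq: "\<exists>\<^sub>F j in sequentially. P (blinfun_apply (b j))" if P: "eventually P (nhds g)" for P
  proof (rule ccontr)
    assume "\<not> ?thesis"
    then have "eventually (\<lambda>h. \<not> P h) (filtermap (\<lambda>j. blinfun_apply (b j)) sequentially)"
      by (simp add: not_frequently eventually_filtermap)
    with P have "eventually (\<lambda>_. False) (inf (nhds g) (filtermap (\<lambda>j. blinfun_apply (b j)) sequentially))"
      unfolding eventually_inf by blast
    with g show False by (simp add: trivial_limit_def)
  qed
  have closed_condition: "g \<in> C" if "closed C" "\<And>j. blinfun_apply (b j) \<in> C" for C
  proof (rule ccontr)
    assume "g \<notin> C"
    then have "eventually (\<lambda>h. h \<in> - C) (nhds g)"
      using that(1) by (intro eventually_nhds_in_open) auto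
    from freq[OF this] that(2) show False by simp
  qed
  have "g (x + y) = g x + g y" for x y
  proof -
    have "closed {h :: 'z \<Rightarrow> real. h (x + y) = h x + h y}"
      by (intro closed_Collect_eq continuous_intros) auto
    from closed_condition[OF this] show ?thesis by (simp add: blinfun.add_right)
  qed
  moreover have "g (r *\<^sub>R x) = r *\<^sub>R g x" for r x
  proof -
    have "closed {h :: 'z \<Rightarrow> real. h (r *\<^sub>R x) = r *\<^sub>R h x}"
      by (intro closed_Collect_eq continuous_intros) auto
    from closed_condition[OF this] show ?thesis by (simp add: blinfun.scaleR_right)
  qed
  moreover have "norm (g x) \<le> norm x * M" for x
    using \<open>g \<in> K\<close> by (auto simp: K_def PiE_iff mult.commute)
  ultimately have "bounded_linear g"
    by (rule bounded_linear_intro)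
  then have "blinfun_apply (Blinfun g) = g"
    by (rule bounded_linear_Blinfun_apply)
  with freq have "weak_star_cluster_point b (Blinfun g)"
    by (simp add: weak_star_cluster_point_def)
  then show thesis by (rule that)
qed

lemma eventually_nhds_evaluation:
  fixes g :: "'z \<Rightarrow> real"
  assumes "open U" "g z \<in> U"
  shows "eventually (\<lambda>h. h z \<in> U) (nhds g)"
proof -
  have "open ((\<lambda>h :: 'z \<Rightarrow> real. h z) -` U)"
    using assms(1) by (intro open_vimage) auto
  then have "eventually (\<lambda>h. h \<in> (\<lambda>h. h z) -` U) (nhds g)"
    using assms(2) by (intro eventually_nhds_in_open) auto
  then show ?thesis by simp
qed

lemma cluster_point_apply_ge:
  fixes b :: "nat \<Rightarrow> ('z::real_normed_vector \<Rightarrow>\<^sub>L real)"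
  assumes cluster: "weak_star_cluster_point b \<phi>"
    and ge: "eventually (\<lambda>j. r \<le> blinfun_apply (b j) z) sequentially"
  shows "r \<le> blinfun_apply \<phi> z"
proof (rule ccontr)
  assume "\<not> ?thesis"
  then have "eventually (\<lambda>h. h z \<in> {..<r}) (nhds (blinfun_apply \<phi>))"
    by (intro eventually_nhds_evaluation) auto
  then have "\<exists>\<^sub>F j in sequentially. blinfun_apply (b j) z \<in> {..<r}"
    using cluster unfolding weak_star_cluster_point_def by blast
  from frequently_eventually_frequently[OF this ge]
  have "\<exists>\<^sub>F j in sequentially. False"
    by (rule frequently_elim1) auto
  then show False by simp
qed

lemma cluster_point_in_closure:
  fixes b :: "nat \<Rightarrow> ('z::real_normed_vector \<Rightarrow>\<^sub>L real)"
  assumes cluster: "weak_star_cluster_point b \<phi>"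
    and mem: "\<And>j. b j \<in> S"
  shows "\<phi> \<in> weak_star_topology closure_of S"
  unfolding in_closure_of strong_operator_topology_topspace
proof (intro conjI allI impI UNIV_I)
  fix T assume "\<phi> \<in> T \<and> openin weak_star_topology T"
  then obtain V where V: "open V" "T = blinfun_apply -` V" "blinfun_apply \<phi> \<in> V"
    unfolding strong_operator_topology_def openin_pullback_topology by auto
  then have "\<exists>\<^sub>F j in sequentially. blinfun_apply (b j) \<in> V"
    using cluster eventually_nhds_in_open[of V "blinfun_apply \<phi>"]
    unfolding weak_star_cluster_point_def by blast
  then obtain j where "blinfun_apply (b j) \<in> V"
    by (auto dest: frequently_ex)
  then show "\<exists>y. y \<in> S \<and> y \<in> T"
    using V(2) mem by auto
qed

lemma closure_evaluation_le:
  assumes "\<phi> \<in> weak_star_topology closure_of S" "\<And>b. b \<in> S \<Longrightarrow> \<bar>blinfun_apply b z\<bar> \<le> r"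
  shows "\<bar>blinfun_apply \<phi> z\<bar> \<le> r"
proof (rule ccontr)
  assume outside: "\<not> ?thesis"
  define T where "T = {f. \<forall>i\<in>{()}. blinfun_apply f z \<in> - {-r..r}}"
  have "openin weak_star_topology T"
    unfolding T_def by (rule strong_operator_topology_basis) auto
  moreover have "\<phi> \<in> T"
    using outside by (auto simp: T_def)
  ultimately obtain b where "b \<in> S" "b \<in> T"
    using assms(1) unfolding in_closure_of by blast
  with assms(2)[of b] show False by (auto simp: T_def)
qed

lemma bidual_embedding_apply [simp]:
  "blinfun_apply (bidual_embedding z) f = blinfun_apply f z"
  by transfer simp

lemma norm_bidual_embedding_le: "norm (bidual_embedding z) \<le> norm z"
proof (rule norm_blinfun_bound)
  show "norm (blinfun_apply (bidual_embedding z) f) \<le> norm z * norm f" for f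
    using norm_blinfun[of f z] by (simp add: mult.commute)
qed simp

lemma bounded_linear_bidual_embedding: "bounded_linear bidual_embedding"
proof (rule bounded_linear_intro[where K = 1])
  show "bidual_embedding (x + y) = bidual_embedding x + bidual_embedding y" for x y :: 'a
    by (rule blinfun_eqI) (simp add: blinfun.add_left blinfun.add_right)
  show "bidual_embedding (r *\<^sub>R x) = r *\<^sub>R bidual_embedding x" for r and x :: 'a
    by (rule blinfun_eqI) (simp add: blinfun.scaleR_left blinfun.scaleR_right)
  show "norm (bidual_embedding x) \<le> norm x * 1" for x :: 'a
    using norm_bidual_embedding_le by simp
qed

section \<open>The dual of \<open>c\<^sub>0\<close> as absolutely summable sequences\<close>

lift_definition unit_c0 :: "nat \<Rightarrow> c0" is "\<lambda>i k. if k = i then 1 else 0"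
proof -
  fix i :: nat
  show "(\<lambda>k. if k = i then 1 else 0 :: real) \<longlonglongrightarrow> 0"
    by (rule tendsto_eventually) (auto simp: eventually_sequentially intro!: exI[of _ "Suc i"])
qed

definition block :: "(nat \<Rightarrow> real) \<Rightarrow> nat \<Rightarrow> nat \<Rightarrow> c0"
  where "block s n m = (\<Sum>k=n..<m. s k *\<^sub>R unit_c0 k)"

abbreviation coef :: "(c0 \<Rightarrow>\<^sub>L real) \<Rightarrow> nat \<Rightarrow> real"
  where "coef f k \<equiv> blinfun_apply f (unit_c0 k)"

definition tail :: "(c0 \<Rightarrow>\<^sub>L real) \<Rightarrow> nat \<Rightarrow> real"
  where "tail f n = (\<Sum>k. \<bar>coef f (k + n)\<bar>)"

text \<open>The action of a bounded sequence, seen as an element of the bidual, on a functional. For a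
  null sequence it is evaluation (\<open>apply_eq_pairing\<close> below), and for arbitrary bounded sequences it
  supplies the bidual elements needed here (\<open>bidual_of_bounded_sequence\<close>).\<close>

definition pairing :: "(nat \<Rightarrow> real) \<Rightarrow> (c0 \<Rightarrow>\<^sub>L real) \<Rightarrow> real"
  where "pairing s f = (\<Sum>k. s k * coef f k)"

lemma seq_of_sum: "seq_of (sum g I) k = (\<Sum>i\<in>I. seq_of (g i) k)"
  by (induction I rule: infinite_finite_induct) auto

lemma seq_of_block: "seq_of (block s n m) k = (if k \<in> {n..<m} then s k else 0)"
  by (simp add: block_def seq_of_sum unit_c0.rep_eq if_distrib sum.delta' cong: if_cong)

lemma apply_block: "blinfun_apply f (block s n m) = (\<Sum>k=n..<m. s k * coef f k)"
  by (simp add: block_def blinfun.sum_right blinfun.scaleR_right)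

lemma norm_block_le:
  assumes "\<And>k. \<bar>s k\<bar> \<le> 1"
  shows "norm (block s n m) \<le> 1"
  using assms by (intro norm_c0_le) (simp add: seq_of_block)

text \<open>Evaluation at the vector of signs of the coefficients, which has norm at most \<open>1\<close>.\<close>

lemma sum_abs_coef_le: "(\<Sum>k=n..<m. \<bar>coef f k\<bar>) \<le> norm f"
proof -
  have "(\<Sum>k=n..<m. \<bar>coef f k\<bar>) = blinfun_apply f (block (\<lambda>k. sgn (coef f k)) n m)"
    by (simp add: apply_block abs_sgn mult.commute)
  also have "\<dots> \<le> norm f * norm (block (\<lambda>k. sgn (coef f k)) n m)"
    using norm_blinfun[of f] by (metis abs_le_D1 real_norm_def)
  also have "\<dots> \<le> norm f * 1"
    by (intro mult_left_mono norm_block_le) (auto simp: sgn_real_def)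
  finally show ?thesis by simp
qed

lemma summable_abs_coef: "summable (\<lambda>k. \<bar>coef f k\<bar>)"
proof (rule summableI_nonneg_bounded)
  show "(\<Sum>k<n. \<bar>coef f k\<bar>) \<le> norm f" for n
    using sum_abs_coef_le[of f 0 n] by (simp add: atLeast0LessThan)
qed simp

lemma summable_abs_coef_shift: "summable (\<lambda>k. \<bar>coef f (k + n)\<bar>)"
  using summable_abs_coef[of f] by (subst summable_iff_shift)

lemma tail_nonneg: "0 \<le> tail f n"
  unfolding tail_def by (intro suminf_nonneg summable_abs_coef_shift) simp

lemma tail_split:
  assumes "n \<le> m"
  shows "tail f n = (\<Sum>k=n..<m. \<bar>coef f k\<bar>) + tail f m"
proof -
  have "tail f n = (\<Sum>k. \<bar>coef f (k + (m - n) + n)\<bar>) + (\<Sum>k<m - n. \<bar>coef f (k + n)\<bar>)"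
    unfolding tail_def
    by (rule suminf_split_initial_segment[OF summable_abs_coef_shift, of f n "m - n"])
  also have "(\<Sum>k. \<bar>coef f (k + (m - n) + n)\<bar>) = tail f m"
    using assms by (simp add: tail_def add.assoc)
  also have "(\<Sum>k<m - n. \<bar>coef f (k + n)\<bar>) = (\<Sum>k=n..<m. \<bar>coef f k\<bar>)"
    using assms sum.shift_bounds_nat_ivl[of "\<lambda>k. \<bar>coef f k\<bar>" 0 n "m - n"]
    by (simp add: atLeast0LessThan)
  finally show ?thesis by simp
qed

lemma tail_antimono: "n \<le> m \<Longrightarrow> tail f m \<le> tail f n"
  using tail_split[of n m f] sum_nonneg[of "{n..<m}" "\<lambda>k. \<bar>coef f k\<bar>"] by simp

lemma tail_tendsto_0: "tail f \<longlonglongrightarrow> 0"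
  unfolding tail_def by (rule suminf_exist_split2) (rule summable_abs_coef)

lemma tail_diff_le: "tail f n \<le> tail (f - g) n + tail g n"
proof -
  have "tail f n \<le> (\<Sum>k. \<bar>coef (f - g) (k + n)\<bar> + \<bar>coef g (k + n)\<bar>)"
    unfolding tail_def
    by (intro suminf_le summable_add summable_abs_coef_shift) (simp add: blinfun.diff_left)
  also have "\<dots> = tail (f - g) n + tail g n"
    unfolding tail_def by (intro suminf_add[symmetric] summable_abs_coef_shift)
  finally show ?thesis .
qed

lemma summable_abs_pairing:
  assumes "\<And>k. \<bar>s k\<bar> \<le> r"
  shows "summable (\<lambda>k. \<bar>s k * coef f k\<bar>)"
proof (rule summable_comparison_test')
  show "summable (\<lambda>k. r * \<bar>coef f k\<bar>)"
    by (intro summable_mult summable_abs_coef)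
  show "norm \<bar>s k * coef f k\<bar> \<le> r * \<bar>coef f k\<bar>" if "0 \<le> k" for k
    using assms[of k] by (simp add: abs_mult mult_right_mono)
qed

lemma pairing_split:
  assumes "\<And>k. \<bar>s k\<bar> \<le> r"
  shows "\<bar>pairing s f - (\<Sum>k<n. s k * coef f k)\<bar> \<le> r * tail f n"
proof -
  have sum: "summable (\<lambda>k. \<bar>s (k + n) * coef f (k + n)\<bar>)"
    using summable_abs_pairing[where s = s and f = f, OF assms]
    by (subst summable_iff_shift[of "\<lambda>k. \<bar>s k * coef f k\<bar>"])
  have "pairing s f - (\<Sum>k<n. s k * coef f k) = (\<Sum>k. s (k + n) * coef f (k + n))"
    unfolding pairing_def
    using suminf_split_initial_segment[OF summable_rabs_cancel[OF summable_abs_pairing[where s = s, OF assms]], where k = n]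
    by simp
  also have "\<bar>\<dots>\<bar> \<le> (\<Sum>k. \<bar>s (k + n) * coef f (k + n)\<bar>)"
    using sum by (rule summable_rabs)
  also have "\<dots> \<le> (\<Sum>k. r * \<bar>coef f (k + n)\<bar>)"
    using assms sum
    by (intro suminf_le summable_mult summable_abs_coef_shift) (auto simp: abs_mult mult_right_mono)
  also have "\<dots> = r * tail f n"
    unfolding tail_def by (intro suminf_mult summable_abs_coef_shift)
  finally show ?thesis .
qed

lemma apply_eq_pairing: "blinfun_apply f x = pairing (seq_of x) f"
proof -
  have lim: "(\<lambda>n. block (seq_of x) 0 n) \<longlonglongrightarrow> x"
  proof (rule LIMSEQ_I)
    fix e :: real assume "e > 0"
    then obtain n0 where n0: "\<And>k. k \<ge> n0 \<Longrightarrow> \<bar>seq_of x k\<bar> < e / 2"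
      using LIMSEQ_D[OF seq_of_tendsto[of x], of "e / 2"] by auto
    have "norm (block (seq_of x) 0 n - x) < e" if "n \<ge> n0" for n
    proof -
      have "norm (block (seq_of x) 0 n - x) \<le> e / 2"
        using n0 that \<open>e > 0\<close> by (intro norm_c0_le) (auto simp: seq_of_block less_imp_le)
      with \<open>e > 0\<close> show ?thesis by simp
    qed
    then show "\<exists>no. \<forall>n\<ge>no. norm (block (seq_of x) 0 n - x) < e" by blast
  qed
  have "(\<lambda>n. \<Sum>k<n. seq_of x k * coef f k) \<longlonglongrightarrow> blinfun_apply f x"
    using bounded_linear.tendsto[OF blinfun.bounded_linear_right lim, of f]
    by (simp add: apply_block atLeast0LessThan)
  then show ?thesis
    unfolding pairing_def by (metis sums_def sums_unique)
qed

lemma apply_tail_bound: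
  assumes "norm x \<le> r"
  shows "\<bar>blinfun_apply f x - (\<Sum>k<n. seq_of x k * coef f k)\<bar> \<le> r * tail f n"
  unfolding apply_eq_pairing[of f x]
  using assms by (intro pairing_split order_trans[OF abs_seq_of_le_norm])

lemma norm_eq_tail_0: "norm f = tail f 0"
proof (rule antisym)
  show "norm f \<le> tail f 0"
    using apply_tail_bound[OF order_refl, of f _ 0] tail_nonneg[of f 0]
    by (intro norm_blinfun_bound) (auto simp: mult.commute)
  have "(\<Sum>k. \<bar>coef f k\<bar>) \<le> norm f"
  proof (rule suminf_le_const[OF summable_abs_coef])
    show "(\<Sum>k<n. \<bar>coef f k\<bar>) \<le> norm f" for n
      using sum_abs_coef_le[of f 0 n] by (simp add: atLeast0LessThan)
  qed
  then show "tail f 0 \<le> norm f"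
    by (simp add: tail_def)
qed

lift_definition coordinate :: "nat \<Rightarrow> c0 \<Rightarrow>\<^sub>L real" is "\<lambda>k x. seq_of x k"
  by (rule bounded_linear_intro[where K = 1]) (auto simp: abs_seq_of_le_norm)

lemma norm_coordinate_le: "norm (coordinate k) \<le> 1"
  by (rule norm_blinfun_bound) (auto simp: coordinate.rep_eq abs_seq_of_le_norm)

lemma coef_coordinate: "coef (coordinate i) k = (if i = k then 1 else 0)"
  by (simp add: coordinate.rep_eq unit_c0.rep_eq)

lemma bidual_of_bounded_sequence:
  assumes "\<And>k. \<bar>s k\<bar> \<le> 1"
  obtains u :: "(c0 \<Rightarrow>\<^sub>L real) \<Rightarrow>\<^sub>L real"
  where "\<And>f. blinfun_apply u f = pairing s f" "norm u \<le> 1"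
proof -
  note summ = summable_rabs_cancel[OF summable_abs_pairing[where s = s, OF assms]]
  have bound: "\<bar>pairing s f\<bar> \<le> norm f" for f
    using pairing_split[where s = s and f = f and n = 0, OF assms] by (simp add: norm_eq_tail_0)
  have "pairing s (f + g) = pairing s f + pairing s g" for f g
    unfolding pairing_def
    by (subst suminf_add[OF summ summ]) (simp add: blinfun.add_left distrib_left)
  moreover have "pairing s (r *\<^sub>R f) = r *\<^sub>R pairing s f" for r f
    unfolding pairing_def real_scaleR_def
    by (subst suminf_mult[OF summ, symmetric]) (simp add: blinfun.scaleR_left mult.left_commute)
  ultimately have "bounded_linear (pairing s)"
    using bound by (intro bounded_linear_intro[where K = 1]) auto
  then have "blinfun_apply (Blinfun (pairing s)) = pairing s"
    by (rule bounded_linear_Blinfun_apply)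
  then show thesis
    using bound by (intro that[of "Blinfun (pairing s)"] norm_blinfun_bound) auto
qed

text \<open>Up to an error measured by tails, an element of the bidual acts like the finitely supported
  vector formed by its first coordinates: removing the first \<open>n\<close> coefficients from \<open>f\<close> leaves a
  functional of norm \<open>tail f n\<close>.\<close>

lemma bidual_head_tail:
  fixes u :: "(c0 \<Rightarrow>\<^sub>L real) \<Rightarrow>\<^sub>L real"
  defines "s \<equiv> \<lambda>k. blinfun_apply u (coordinate k)"
  shows "\<bar>blinfun_apply u f - blinfun_apply f (block s 0 n)\<bar> \<le> norm u * tail f n"
proof -
  define h where "h = f - (\<Sum>k<n. coef f k *\<^sub>R coordinate k)"
  have coef_h: "coef h k = (if k < n then 0 else coef f k)" for k
    by (simp add: h_def blinfun.diff_left blinfun.sum_left blinfun.scaleR_left coef_coordinate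
        if_distrib sum.delta' cong: if_cong)
  have "tail h 0 = tail h n"
    using tail_split[of 0 n h] by (simp add: coef_h)
  also have "\<dots> = tail f n"
    by (simp add: tail_def coef_h)
  finally have norm_h: "norm h = tail f n"
    by (simp add: norm_eq_tail_0)
  have "blinfun_apply u f - blinfun_apply f (block s 0 n) = blinfun_apply u h"
    by (simp add: h_def s_def apply_block blinfun.diff_right blinfun.sum_right
        blinfun.scaleR_right atLeast0LessThan mult.commute)
  then show ?thesis
    using norm_blinfun[of u h] by (simp add: norm_h)
qed

section \<open>The uniform tail of a set of functionals\<close>

definition uniform_tail :: "(c0 \<Rightarrow>\<^sub>L real) set \<Rightarrow> ennreal"
  where "uniform_tail A = (INF n. SUP f\<in>A. ennreal (tail f n))"

lemma less_uniform_tailD: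
  assumes "ennreal c < uniform_tail A"
  shows "\<exists>f\<in>A. c < tail f n"
proof -
  have "ennreal c < (SUP f\<in>A. ennreal (tail f n))"
    using assms unfolding uniform_tail_def by (rule less_INF_D) simp
  then obtain f where "f \<in> A" "ennreal c < ennreal (tail f n)"
    by (auto simp: less_SUP_iff)
  then show ?thesis
    using ennreal_leI[of "tail f n" c] by (auto simp: not_less[symmetric])
qed


lemma uniform_tail_leI:
  assumes "\<And>c. 0 \<le> c \<Longrightarrow> ennreal c < uniform_tail A \<Longrightarrow> ennreal c \<le> X"
  shows "uniform_tail A \<le> X"
proof (rule dense_le)
  fix y assume "y < uniform_tail A"
  then show "y \<le> X"
    using assms by (cases y) auto
qed

section \<open>Gliding humps\<close>

text \<open>If every starting point admits a block and an object related to it, then consecutive blocks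
  can be chosen so that each ends where the next one begins.\<close>

lemma gliding_hump_sequence:
  assumes "\<And>n. \<exists>m a. n < m \<and> P n m a"
  obtains N :: "nat \<Rightarrow> nat" and a where "strict_mono N" "\<And>k. P (N k) (N (Suc k)) (a k)"
proof -
  obtain next_end hump where step: "\<And>n. n < next_end n \<and> P n (next_end n) (hump n)"
    using assms by metis
  define N where "N k = (next_end ^^ k) 0" for k
  have "strict_mono N"
    by (rule strict_mono_Suc_iff[THEN iffD2]) (simp add: N_def step)
  moreover have "P (N k) (N (Suc k)) (hump (N k))" for k
    using step by (simp add: N_def)
  ultimately show thesis by (rule that)
qed

text \<open>Since the blocks are disjoint, a single sign sequence can follow a different sequence \<open>d k\<close>
  on each block.\<close>

lemma signs_on_blocks:
  fixes d :: "nat \<Rightarrow> nat \<Rightarrow> real"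
  assumes "strict_mono N"
  obtains s :: "nat \<Rightarrow> real" where "\<And>i. \<bar>s i\<bar> \<le> 1"
    "\<And>k i. i \<in> {N k..<N (Suc k)} \<Longrightarrow> s i = sgn (d k i)"
proof -
  have block_index: "(LEAST k. i < N (Suc k)) = k" if "i \<in> {N k..<N (Suc k)}" for i k
  proof (rule Least_equality)
    show "k \<le> y" if "i < N (Suc y)" for y
    proof (rule ccontr)
      assume "\<not> k \<le> y"
      then have "N (Suc y) \<le> N k"
        using assms by (simp add: strict_mono_less_eq)
      with that \<open>i \<in> {N k..<N (Suc k)}\<close> show False by simp
    qed
  qed (use that in simp)
  show thesis
    by (rule that[of "\<lambda>i. sgn (d (LEAST k. i < N (Suc k)) i)"])
      (auto simp: sgn_real_def block_index)
qed

text \<open>Vectors with entries in \<open>[-1, 1]\<close> on disjoint blocks read off disjoint parts of the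
  coefficients of \<open>f\<close>. This makes such a sequence weakly 1-summable with norm at most \<open>1\<close>.\<close>

lemma sum_apply_blocks_le:
  assumes "strict_mono N" "\<And>j k. \<bar>s j k\<bar> \<le> 1"
  shows "(\<Sum>j<J. \<bar>blinfun_apply f (block (s j) (N j) (N (Suc j)))\<bar>) \<le> norm f"
proof -
  have "(\<Sum>j<J. \<bar>blinfun_apply f (block (s j) (N j) (N (Suc j)))\<bar>)
      \<le> (\<Sum>j<J. \<Sum>k=N j..<N (Suc j). \<bar>coef f k\<bar>)"
  proof (rule sum_mono)
    fix j
    have "\<bar>blinfun_apply f (block (s j) (N j) (N (Suc j)))\<bar>
        \<le> (\<Sum>k=N j..<N (Suc j). \<bar>s j k * coef f k\<bar>)"
      unfolding apply_block by (rule sum_abs)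
    also have "\<dots> \<le> (\<Sum>k=N j..<N (Suc j). \<bar>coef f k\<bar>)"
      using assms(2) by (intro sum_mono) (simp add: abs_mult mult_left_le_one_le)
    finally show "\<bar>blinfun_apply f (block (s j) (N j) (N (Suc j)))\<bar>
        \<le> (\<Sum>k=N j..<N (Suc j). \<bar>coef f k\<bar>)" .
  qed
  also have "\<dots> = (\<Sum>k=N 0..<N J. \<bar>coef f k\<bar>)"
  proof (induction J)
    case (Suc J)
    then show ?case
      using assms(1) sum.atLeastLessThan_concat[of "N 0" "N J" "N (Suc J)" "\<lambda>k. \<bar>coef f k\<bar>"]
      by (simp add: strict_mono_less_eq)
  qed simp
  also have "\<dots> \<le> norm f"
    by (rule sum_abs_coef_le)
  finally show ?thesis .
qed

section \<open>The measure \<open>\<eta>\<^sub>1\<close> is the uniform tail\<close>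

text \<open>The coefficients of the functionals in \<open>A\<close> are uniformly bounded by some \<open>M\<close>, so on the
  first \<open>N\<close> coordinates all of them are small on \<open>x n\<close> at the same time once \<open>n\<close> is large.\<close>

lemma eta1_le_uniform_tail:
  assumes "bounded A"
  shows "eta1 A \<le> uniform_tail A"
  unfolding eta1_def
proof (rule SUP_least, clarsimp)
  fix x :: "nat \<Rightarrow> c0"
  assume summ: "weakly_1_summable x" and weak_norm: "weak_1_norm x \<le> 1"
  obtain M where M: "M > 0" "\<And>f. f \<in> A \<Longrightarrow> norm f \<le> M"
    using assms unfolding bounded_pos by blast
  \<comment> \<open>The coordinate functionals lie in the dual unit ball, so the weak 1-norm dominates every
    coordinate of every term.\<close>
  have norm_x: "norm (x n) \<le> 1" for n
  proof (rule norm_c0_le)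
    fix k
    let ?a = "\<lambda>n. ennreal \<bar>blinfun_apply (coordinate k) (x n)\<bar>"
    have "?a n \<le> (\<Sum>n. ?a n)"
    proof -
      have "sum ?a {n} \<le> (\<Sum>n. ?a n)"
        by (rule sum_le_suminf) auto
      also have "sum ?a {n} = ?a n"
        by (rule trans[OF sum.insert]) auto
      finally show ?thesis .
    qed
    also have "\<dots> \<le> weak_1_norm x"
      unfolding weak_1_norm_def by (rule SUP_upper) (simp add: norm_coordinate_le)
    also note weak_norm
    finally show "\<bar>seq_of (x n) k\<bar> \<le> 1"
      by (simp only: coordinate.rep_eq ennreal_le_1)
  qed
  have coord_lim: "(\<lambda>n. \<bar>seq_of (x n) k\<bar>) \<longlonglongrightarrow> 0" for k
  proof -
    have "summable (\<lambda>n. \<bar>blinfun_apply (coordinate k) (x n)\<bar>)"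
      using summ unfolding weakly_1_summable_def by blast
    then show ?thesis
      by (simp only: coordinate.rep_eq) (rule summable_LIMSEQ_zero)
  qed
  show "limsup (\<lambda>n. SUP f\<in>A. ennreal \<bar>blinfun_apply f (x n)\<bar>) \<le> uniform_tail A"
    unfolding uniform_tail_def
  proof (rule INF_greatest, rule ennreal_le_epsilon)
    fix N :: nat and e :: real assume "0 < e"
    have "(\<lambda>n. M * (\<Sum>k<N. \<bar>seq_of (x n) k\<bar>)) \<longlonglongrightarrow> M * (\<Sum>k<N. 0)"
      by (intro tendsto_intros coord_lim)
    then have small: "eventually (\<lambda>n. M * (\<Sum>k<N. \<bar>seq_of (x n) k\<bar>) < e) sequentially"
      using \<open>0 < e\<close> by (intro order_tendstoD(2)) auto
    show "limsup (\<lambda>n. SUP f\<in>A. ennreal \<bar>blinfun_apply f (x n)\<bar>)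
        \<le> (SUP f\<in>A. ennreal (tail f N)) + ennreal e"
    proof (rule Limsup_bounded, rule eventually_mono[OF small], rule SUP_least)
      fix n f assume head: "M * (\<Sum>k<N. \<bar>seq_of (x n) k\<bar>) < e" and "f \<in> A"
      have "\<bar>\<Sum>k<N. seq_of (x n) k * coef f k\<bar> \<le> (\<Sum>k<N. M * \<bar>seq_of (x n) k\<bar>)"
      proof (rule order_trans[OF sum_abs], rule sum_mono)
        fix k
        have "\<bar>coef f k\<bar> \<le> M"
          using sum_abs_coef_le[of f k "Suc k"] M(2)[OF \<open>f \<in> A\<close>] by simp
        then show "\<bar>seq_of (x n) k * coef f k\<bar> \<le> M * \<bar>seq_of (x n) k\<bar>"
          by (simp add: abs_mult mult.commute mult_right_mono)
      qed
      also have "\<dots> < e"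
        using head by (simp add: sum_distrib_left)
      finally have "\<bar>blinfun_apply f (x n)\<bar> \<le> tail f N + e"
        using apply_tail_bound[OF norm_x[of n], of f N] by linarith
      then have "ennreal \<bar>blinfun_apply f (x n)\<bar> \<le> ennreal (tail f N) + ennreal e"
        using \<open>0 < e\<close> by (simp add: tail_nonneg flip: ennreal_plus)
      also have "\<dots> \<le> (SUP f\<in>A. ennreal (tail f N)) + ennreal e"
        using \<open>f \<in> A\<close> by (intro add_right_mono SUP_upper)
      finally show "ennreal \<bar>blinfun_apply f (x n)\<bar>
        \<le> (SUP f\<in>A. ennreal (tail f N)) + ennreal e" .
    qed
  qed
qed

text \<open>A tail larger than \<open>c\<close> already has mass larger than \<open>c\<close> on a finite block. The sign vectors on
  consecutive blocks of this kind are admissible in the definition of \<open>\<eta>\<^sub>1\<close> and detect that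
  mass.\<close>

lemma uniform_tail_le_eta1: "uniform_tail A \<le> eta1 A"
proof (rule uniform_tail_leI)
  fix c assume "0 \<le> c" and c: "ennreal c < uniform_tail A"
  have "\<exists>m f. n < m \<and> f \<in> A \<and> c < (\<Sum>k=n..<m. \<bar>coef f k\<bar>)" for n
  proof -
    obtain f where f: "f \<in> A" "c < tail f n"
      using less_uniform_tailD[OF c] by blast
    have "eventually (\<lambda>m. n < m \<and> tail f m < tail f n - c) sequentially"
      using f(2) by (intro eventually_conj eventually_gt_at_top order_tendstoD(2)[OF tail_tendsto_0]) simp
    then obtain m where "n < m" "tail f m < tail f n - c"
      by (auto simp: eventually_sequentially)
    with f(1) tail_split[of n m f] show ?thesis by (intro exI[of _ m] exI[of _ f]) auto
  qed
  then obtain N f where N: "strict_mono N"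
    and f: "\<And>j. f j \<in> A \<and> c < (\<Sum>k=N j..<N (Suc j). \<bar>coef (f j) k\<bar>)"
    by (rule gliding_hump_sequence[where P = "\<lambda>n m f. f \<in> A \<and> c < (\<Sum>k=n..<m. \<bar>coef f k\<bar>)"])
      (rule that)
  define x where "x j = block (\<lambda>k. sgn (coef (f j) k)) (N j) (N (Suc j))" for j
  have sums: "(\<Sum>j<J. \<bar>blinfun_apply g (x j)\<bar>) \<le> norm g" for g J
    unfolding x_def using N by (intro sum_apply_blocks_le) (auto simp: sgn_real_def)
  have summ: "summable (\<lambda>j. \<bar>blinfun_apply g (x j)\<bar>)"
    for g :: "c0 \<Rightarrow>\<^sub>L real"
    by (rule summableI_nonneg_bounded[where x = "norm g"]) (simp_all add: sums)
  have "weak_1_norm x \<le> 1"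
    unfolding weak_1_norm_def
  proof (rule SUP_least)
    fix g :: "c0 \<Rightarrow>\<^sub>L real" assume "g \<in> cball 0 1"
    then have "(\<Sum>j. \<bar>blinfun_apply g (x j)\<bar>) \<le> 1"
      using suminf_le_const[OF summ[of g], of "norm g"] sums[of g] by simp
    then show "(\<Sum>j. ennreal \<bar>blinfun_apply g (x j)\<bar>) \<le> 1"
      by (simp add: suminf_ennreal2[OF _ summ])
  qed
  then have "limsup (\<lambda>n. SUP f\<in>A. ennreal \<bar>blinfun_apply f (x n)\<bar>) \<le> eta1 A"
    unfolding eta1_def using summ by (intro SUP_upper) (auto simp: weakly_1_summable_def)
  moreover have "ennreal c \<le> limsup (\<lambda>n. SUP f\<in>A. ennreal \<bar>blinfun_apply f (x n)\<bar>)"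
  proof (rule le_Limsup)
    have "ennreal c \<le> (SUP f\<in>A. ennreal \<bar>blinfun_apply f (x n)\<bar>)" for n
    proof (rule SUP_upper2)
      have "blinfun_apply (f n) (x n) = (\<Sum>k=N n..<N (Suc n). \<bar>coef (f n) k\<bar>)"
        by (simp add: x_def apply_block abs_sgn mult.commute)
      then show "ennreal c \<le> ennreal \<bar>blinfun_apply (f n) (x n)\<bar>"
        using f[of n] by (intro ennreal_leI) simp
    qed (use f in simp)
    then show "eventually (\<lambda>n. ennreal c \<le> (SUP f\<in>A. ennreal \<bar>blinfun_apply f (x n)\<bar>)) sequentially"
      by simp
  qed simp
  ultimately show "ennreal c \<le> eta1 A" by (rule order_trans[rotated])
qed

section \<open>The distance from \<open>X\<^sup>*\<close> is the uniform tail\<close>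

text \<open>The restriction of \<open>\<phi>\<close> to \<open>c\<^sub>0\<close> is the element of the dual that witnesses the bound on the
  distance.\<close>

lemma wk_le_uniform_tail: "wk A \<le> uniform_tail A"
  unfolding wk_def uniform_tail_def
proof (intro SUP_least INF_greatest)
  fix \<phi> :: "((c0 \<Rightarrow>\<^sub>L real) \<Rightarrow>\<^sub>L real) \<Rightarrow>\<^sub>L real" and N :: nat
  assume \<phi>: "\<phi> \<in> weak_star_topology closure_of (bidual_embedding ` A)"
  show "ennreal (infdist \<phi> (range bidual_embedding)) \<le> (SUP f\<in>A. ennreal (tail f N))"
  proof (cases "SUP f\<in>A. ennreal (tail f N)")
    case (real t)
    have tail_le: "tail a m \<le> t" if "a \<in> A" "N \<le> m" for a m
    proof -
      have "ennreal (tail a N) \<le> ennreal t"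
        using that(1) by (simp flip: real(2)) (intro SUP_upper)
      then show ?thesis
        using tail_antimono[OF that(2), of a] real(1) by simp
    qed
    define f where "f = \<phi> o\<^sub>L Blinfun bidual_embedding"
    have f_apply: "blinfun_apply f x = blinfun_apply \<phi> (bidual_embedding x)" for x
      by (simp add: f_def bounded_linear_Blinfun_apply[OF bounded_linear_bidual_embedding])
    have norm_le: "norm (\<phi> - bidual_embedding f) \<le> t + tail f m" if "N \<le> m" for m
    proof (rule norm_blinfun_bound)
      show "0 \<le> t + tail f m"
        using real(1) tail_nonneg[of f m] by simp
      fix u :: "(c0 \<Rightarrow>\<^sub>L real) \<Rightarrow>\<^sub>L real"
      \<comment> \<open>Split \<open>u\<close> into a vector \<open>x\<close> of \<open>c\<^sub>0\<close>, on which \<open>\<phi>\<close> and \<open>f\<close> agree, and a remainder \<open>v\<close>.\<close>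
      define x where "x = block (\<lambda>k. blinfun_apply u (coordinate k)) 0 m"
      define v where "v = u - bidual_embedding x"
      have v_le: "\<bar>blinfun_apply v g\<bar> \<le> norm u * tail g m" for g
        using bidual_head_tail[of u g m] by (simp add: v_def x_def blinfun.diff_left)
      have "\<bar>blinfun_apply \<phi> v\<bar> \<le> norm u * t"
      proof (rule closure_evaluation_le[OF \<phi>])
        fix b assume "b \<in> bidual_embedding ` A"
        then obtain a where "a \<in> A" "b = bidual_embedding a" by blast
        then show "\<bar>blinfun_apply b v\<bar> \<le> norm u * t"
          using order_trans[OF v_le mult_left_mono[OF tail_le[OF _ that]]] by simp
      qed
      moreover have "blinfun_apply (\<phi> - bidual_embedding f) u
          = blinfun_apply \<phi> v - blinfun_apply v f"
        by (simp add: v_def blinfun.diff_left blinfun.diff_right f_apply)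
      ultimately show "norm (blinfun_apply (\<phi> - bidual_embedding f) u) \<le> (t + tail f m) * norm u"
        using v_le[of f] by (simp add: algebra_simps)
    qed
    \<comment> \<open>The bound \<open>t\<close> holds for all tails of \<open>A\<close> from \<open>N\<close> on, so \<open>m\<close> can grow and remove the
      tail of \<open>f\<close>.\<close>
    have "norm (\<phi> - bidual_embedding f) \<le> t + 0"
    proof (rule LIMSEQ_le_const)
      show "(\<lambda>m. t + tail f m) \<longlonglongrightarrow> t + 0"
        by (intro tendsto_intros tail_tendsto_0)
    qed (use norm_le in blast)
    moreover have "infdist \<phi> (range bidual_embedding) \<le> dist \<phi> (bidual_embedding f)"
      by (intro infdist_le) simp
    ultimately show ?thesis
      unfolding real(2) by (intro ennreal_leI) (simp add: dist_norm)
  next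
    case top
    then show ?thesis by (simp only: top_greatest)
  qed
qed

text \<open>Two cluster points are needed: \<open>f\<close> on \<open>c\<^sub>0\<close>, so that the differences to \<open>f\<close> become small on
  every initial segment and hence have humps that glide, and then \<open>\<phi>\<close> on the bidual, which is
  the element of the closure far from the dual.\<close>

lemma uniform_tail_le_wk:
  assumes "bounded A"
  shows "uniform_tail A \<le> wk A"
proof (rule uniform_tail_leI, rule ennreal_le_epsilon)
  fix c e' :: real assume "0 \<le> c" and c: "ennreal c < uniform_tail A" and "0 < e'"
  \<comment> \<open>Three errors occur: before the block, on the block and after it.\<close>
  define e where "e = e' / 3"
  have "0 < e" using \<open>0 < e'\<close> by (simp add: e_def)
  obtain M where M: "\<And>f. f \<in> A \<Longrightarrow> norm f \<le> M"
    using assms unfolding bounded_iff by blast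
  obtain a where a: "\<And>n. a n \<in> A" "\<And>n. c < tail (a n) n"
    using less_uniform_tailD[OF c] by metis
  obtain f where f: "weak_star_cluster_point a f"
    using weak_star_cluster_point_exists[of a M] M a(1) by blast
  have "\<exists>m g. n < m \<and> g \<in> A \<and> (\<Sum>k<n. \<bar>coef (g - f) k\<bar>) < e \<and>
      c - e < (\<Sum>k=n..<m. \<bar>coef (g - f) k\<bar>) \<and> tail (g - f) m < e" for n
  proof -
    have "open {h :: c0 \<Rightarrow> real. (\<Sum>k<n. \<bar>h (unit_c0 k) - coef f k\<bar>) < e}"
      by (intro open_Collect_less continuous_intros) auto
    then have "eventually (\<lambda>h. h \<in> {h. (\<Sum>k<n. \<bar>h (unit_c0 k) - coef f k\<bar>) < e})
        (nhds (blinfun_apply f))"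
      using \<open>0 < e\<close> by (intro eventually_nhds_in_open) auto
    then have "\<exists>\<^sub>F j in sequentially. (\<Sum>k<n. \<bar>coef (a j) k - coef f k\<bar>) < e"
      using f unfolding weak_star_cluster_point_def by fastforce
    moreover have "eventually (\<lambda>j. n \<le> j \<and> tail f j < e) sequentially"
      using \<open>0 < e\<close>
      by (intro eventually_conj eventually_ge_at_top order_tendstoD(2)[OF tail_tendsto_0])
    ultimately obtain j where j: "(\<Sum>k<n. \<bar>coef (a j) k - coef f k\<bar>) < e" "n \<le> j" "tail f j < e"
      by (blast dest: frequently_eventually_frequently frequently_ex)
    have "c - e < tail (a j - f) n"
      using a(2)[of j] j(3) tail_diff_le[of "a j" j f] tail_antimono[OF j(2), of "a j - f"] by linarith
    then have "eventually (\<lambda>m. n < m \<and> tail (a j - f) m < tail (a j - f) n - (c - e)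
        \<and> tail (a j - f) m < e) sequentially"
      using \<open>0 < e\<close>
      by (intro eventually_conj eventually_gt_at_top order_tendstoD(2)[OF tail_tendsto_0]) auto
    then obtain m where "n < m" "tail (a j - f) m < tail (a j - f) n - (c - e)"
        "tail (a j - f) m < e"
      by (auto simp: eventually_sequentially)
    with a(1)[of j] j(1) tail_split[of n m "a j - f"] show ?thesis
      by (intro exI[of _ m] exI[of _ "a j"]) (auto simp: blinfun.diff_left)
  qed
  then obtain N g where N: "strict_mono N"
    and g: "\<And>k. g k \<in> A \<and> (\<Sum>i<N k. \<bar>coef (g k - f) i\<bar>) < e \<and>
      c - e < (\<Sum>i=N k..<N (Suc k). \<bar>coef (g k - f) i\<bar>) \<and> tail (g k - f) (N (Suc k)) < e"
    by (rule gliding_hump_sequence[where P = "\<lambda>n m g. g \<in> A \<and> (\<Sum>k<n. \<bar>coef (g - f) k\<bar>) < e \<and>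
      c - e < (\<Sum>k=n..<m. \<bar>coef (g - f) k\<bar>) \<and> tail (g - f) m < e"])
      (rule that)
  obtain s :: "nat \<Rightarrow> real" where s: "\<And>i. \<bar>s i\<bar> \<le> 1"
    "\<And>k i. i \<in> {N k..<N (Suc k)} \<Longrightarrow> s i = sgn (coef (g k - f) i)"
    using signs_on_blocks[OF N, of "\<lambda>k. coef (g k - f)"] by metis
  \<comment> \<open>Deleting the terms of \<open>s\<close> before the \<open>K\<close>-th block keeps the humps from \<open>K\<close> on, but makes the
    pairing with a fixed functional tend to \<open>0\<close> as \<open>K\<close> grows.\<close>
  define s' where "s' K i = (if i < N K then 0 else s i)" for K i
  have s'_le: "\<bar>s' K i\<bar> \<le> 1" for K i
    using s(1)[of i] by (simp add: s'_def)
  have "\<exists>v. (\<forall>h. blinfun_apply v h = pairing (s' K) h) \<and> norm v \<le> 1" for K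
    by (rule bidual_of_bounded_sequence[where s = "s' K", OF s'_le]) blast
  then obtain u where u: "\<And>K h. blinfun_apply (u K) h = pairing (s' K) h" "\<And>K. norm (u K) \<le> 1"
    by metis
  have hump: "c - 3 * e \<le> blinfun_apply (u K) (g k - f)" if "K \<le> k" for K k
  proof -
    let ?d = "g k - f"
    have "N K \<le> N k" "N k \<le> N (Suc k)"
      using N that by (simp_all add: strict_mono_less_eq)
    then have "(\<Sum>i=N k..<N (Suc k). s' K i * coef ?d i) = (\<Sum>i=N k..<N (Suc k). \<bar>coef ?d i\<bar>)"
      by (intro sum.cong) (auto simp: s'_def s(2)[of _ k] abs_sgn mult.commute)
    moreover have "\<bar>\<Sum>i<N k. s' K i * coef ?d i\<bar> \<le> (\<Sum>i<N k. \<bar>coef ?d i\<bar>)"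
    proof (rule order_trans[OF sum_abs], rule sum_mono)
      show "\<bar>s' K i * coef ?d i\<bar> \<le> \<bar>coef ?d i\<bar>" for i
        using s'_le[of K i] by (simp add: abs_mult mult_left_le_one_le)
    qed
    moreover have "(\<Sum>i<N (Suc k). s' K i * coef ?d i)
        = (\<Sum>i<N k. s' K i * coef ?d i) + (\<Sum>i=N k..<N (Suc k). s' K i * coef ?d i)"
      using sum.atLeastLessThan_concat[of 0 "N k" "N (Suc k)" "\<lambda>i. s' K i * coef ?d i"]
        \<open>N k \<le> N (Suc k)\<close> by (simp add: atLeast0LessThan)
    moreover have "\<bar>pairing (s' K) ?d - (\<Sum>i<N (Suc k). s' K i * coef ?d i)\<bar>
        \<le> tail ?d (N (Suc k))"
      using pairing_split[where s = "s' K" and f = ?d and n = "N (Suc k)", OF s'_le] by simp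
    ultimately show ?thesis
      unfolding u(1) using g[of k] by linarith
  qed
  have far: "\<bar>blinfun_apply (u K) h\<bar> \<le> tail h (N K)" for K h
    using pairing_split[where s = "s' K" and f = h and n = "N K", OF s'_le] by (simp add: u(1) s'_def)
  have "norm (bidual_embedding (g k)) \<le> M" for k
    using norm_bidual_embedding_le M g order_trans by blast
  then obtain \<phi> where \<phi>: "weak_star_cluster_point (\<lambda>k. bidual_embedding (g k)) \<phi>"
    using weak_star_cluster_point_exists[of "\<lambda>k. bidual_embedding (g k)" M] by blast
  have \<phi>_closure: "\<phi> \<in> weak_star_topology closure_of (bidual_embedding ` A)"
    by (rule cluster_point_in_closure[OF \<phi>]) (use g in auto)
  have \<phi>_u: "c - 3 * e + blinfun_apply (u K) f \<le> blinfun_apply \<phi> (u K)" for K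
  proof (rule cluster_point_apply_ge[OF \<phi>])
    show "eventually (\<lambda>k. c - 3 * e + blinfun_apply (u K) f
        \<le> blinfun_apply (bidual_embedding (g k)) (u K)) sequentially"
      using eventually_ge_at_top[of K]
    proof eventually_elim
      case (elim k)
      then show ?case using hump[of K k] by (simp add: blinfun.diff_right)
    qed
  qed
  have dist_ge: "c - 3 * e \<le> dist \<phi> (bidual_embedding h)" for h
  proof -
    have "c - 3 * e - tail (f - h) (N K) \<le> norm (\<phi> - bidual_embedding h)" for K
    proof -
      have "c - 3 * e - tail (f - h) (N K) \<le> blinfun_apply (\<phi> - bidual_embedding h) (u K)"
        using \<phi>_u[of K] far[of K "f - h"] by (simp add: blinfun.diff_left blinfun.diff_right)
      also have "\<dots> \<le> norm (\<phi> - bidual_embedding h) * norm (u K)"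
        using norm_blinfun[of "\<phi> - bidual_embedding h" "u K"] by simp
      also have "\<dots> \<le> norm (\<phi> - bidual_embedding h)"
        using u(2)[of K] by (intro mult_right_le_one_le) auto
      finally show ?thesis .
    qed
    moreover have "(\<lambda>K. c - 3 * e - tail (f - h) (N K)) \<longlonglongrightarrow> c - 3 * e - 0"
      using LIMSEQ_subseq_LIMSEQ[OF tail_tendsto_0 N, of "f - h"]
      by (intro tendsto_intros) (simp add: comp_def)
    ultimately show ?thesis
      by (auto simp: dist_norm intro: LIMSEQ_le_const2)
  qed
  have "c - e' \<le> infdist \<phi> (range bidual_embedding)"
  proof -
    have "c - e' \<le> (INF z\<in>range bidual_embedding. dist \<phi> z)"
      using dist_ge by (intro cINF_greatest) (auto simp: e_def)
    then show ?thesis by (simp add: infdist_notempty)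
  qed
  then have "ennreal c \<le> ennreal (infdist \<phi> (range bidual_embedding) + e')"
    by (intro ennreal_leI) simp
  also have "\<dots> = ennreal (infdist \<phi> (range bidual_embedding)) + ennreal e'"
    using \<open>0 < e'\<close> by (simp add: infdist_nonneg)
  also have "\<dots> \<le> wk A + ennreal e'"
    unfolding wk_def using \<phi>_closure by (intro add_right_mono SUP_upper)
  finally show "ennreal c \<le> wk A + ennreal e'" .
qed

theorem theorem4p11:
  fixes A :: "(c0 \<Rightarrow>\<^sub>L real) set"
  assumes "bounded A"
  shows "wk A = eta1 A"
proof -
  have "wk A = uniform_tail A"
    using wk_le_uniform_tail uniform_tail_le_wk[OF assms] by (rule antisym)
  also have "uniform_tail A = eta1 A"
    using uniform_tail_le_eta1 eta1_le_uniform_tail[OF assms] by (rule antisym)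
  finally show ?thesis .
qed

end
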